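(* Let $X$ be a measurable space. Then $\mathrm{Mor}(X,X) = \mathrm{Map}(X,X)$ if and only if $X$ has the trivial $\sigma$-algebra or the discrete $\sigma$-algebra.
   Context: A measurable space is a set equipped with a $\sigma$-algebra. $\mathrm{Mor}(X,X)$ is the set of measurable maps from $X$ to $X$, and $\mathrm{Map}(X,X)$ is the set of all maps from $X$ to $X$. The trivial $\sigma$-algebra on $X$ is $\{\emptyset, X\}$; the discrete $\sigma$-algebra consists of all subsets of $X$. *)

theory Defs
  imports "HOL-Analysis.Sigma_Algebra"
begin

end

theory Submission
  imports Defs
begin

text \<open>A measurable set \<open>A\<close> other than \<open>{}\<close> and
  \<open>space X\<close> separates some \<open>a\<close> in it from some \<open>b\<close> outside,
  so every subset is the preimage of \<open>A\<close> under a map with values \<open>a\<close> and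
  \<open>b\<close>. Conversely, a self-map pulls \<open>{}\<close> and \<open>space X\<close> back
  to themselves, and in the discrete case every preimage is measurable.\<close>

theorem corollary2:
  fixes X :: "'a measure"
  shows "measurable X X = (space X \<rightarrow> space X) \<longleftrightarrow>
    sets X = {{}, space X} \<or> sets X = Pow (space X)"
proof
  assume all_measurable: "measurable X X = (space X \<rightarrow> space X)"
  show "sets X = {{}, space X} \<or> sets X = Pow (space X)"
  proof (cases "sets X \<subseteq> {{}, space X}")
    case True
    \<comment> \<open>The other inclusion holds in any \<sigma>-algebra.\<close>
    then show ?thesis by auto
  next
    case False
    then obtain A where A: "A \<in> sets X" "A \<noteq> {}" "A \<noteq> space X" by auto
    then have "A \<subseteq> space X" by (blast dest: sets.sets_into_space)
    with A obtain a b where ab: "a \<in> A" "b \<in> space X - A" by blast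
    have "S \<in> sets X" if S: "S \<subseteq> space X" for S
    proof -
      \<comment> \<open>The two-valued map sending S into A and its complement outside A pulls A back to S.\<close>
      let ?f = "\<lambda>x. if x \<in> S then a else b"
      have "?f \<in> space X \<rightarrow> space X" using ab \<open>A \<subseteq> space X\<close> by auto
      then have "?f \<in> measurable X X" using all_measurable by blast
      then have "?f -` A \<inter> space X \<in> sets X" using A(1) by (rule measurable_sets)
      moreover have "?f -` A \<inter> space X = S" using ab S by (auto split: if_splits)
      ultimately show ?thesis by simp
    qed
    then show ?thesis by (auto dest: sets.sets_into_space)
  qed
next
  assume "sets X = {{}, space X} \<or> sets X = Pow (space X)"
  \<comment> \<open>Beyond mapping \<open>space X\<close> into itself, measurability demands only
    this.\<close>
  then have "f -` A \<inter> space X \<in> sets X"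
    if "f \<in> space X \<rightarrow> space X" "A \<in> sets X" for f A
  proof
    assume "sets X = {{}, space X}"
    moreover have "f -` space X \<inter> space X = space X" using that(1) by auto
    ultimately show ?thesis using that(2) by auto
  qed auto
  then show "measurable X X = (space X \<rightarrow> space X)"
    by (auto simp: measurable_def)
qed

end
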